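(* Let $D=(V,A)$ be a directed graph, $s,t\in V$ distinct, and $c:A\to\mathbb{R}_{\geq 0}$ an arc cost function. Let $p$ be a shortest $s$-$t$-path in $D$ with respect to $c$, and let $\ell$ be the number of arcs of $p$. Define $\gamma_p:A\to\mathbb{R}^2_{\geq 0}$ by $\gamma_{p,1}(a)=c(a)$ for all $a\in A$, and $\gamma_{p,2}(a)=1$ if $a\in p$ and $\gamma_{p,2}(a)=0$ otherwise. Consider the biobjective shortest path instance $(D,s,t,\gamma_p)$. Then a lexicographically smallest (with respect to $\gamma_p$) efficient $s$-$t$-path $q$ with $\gamma_{p,2}(q)<\ell$ in this instance is a second shortest simple $s$-$t$-path in $D$ with respect to $c$, i.e. $q$ is a simple $s$-$t$-path, $q\neq p$, and $c(q)\leq c(q')$ for every simple $s$-$t$-path $q'\neq p$.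
   Context: Paths are sequences of arcs; the cost of a path under a (vector) arc cost function is the (componentwise) sum of the costs of its arcs. In the biobjective instance $(D,s,t,\gamma_p)$ the feasible solutions are the simple $s$-$t$-paths of $D$. A path $q'$ dominates $q$ if $\gamma_{p,i}(q')\leq\gamma_{p,i}(q)$ for $i\in\{1,2\}$ with at least one inequality strict; a feasible path is efficient if no feasible path dominates it. The lexicographic order compares $\gamma_{p,1}$ first and then $\gamma_{p,2}$. *)

theory Defs
  imports "Graph_Theory.Weighted_Graph"
begin

text \<open>
  Directed graphs are the arc-labelled digraphs of the Graph Theory library. A path is an arc
  sequence: \<^const>\<open>pre_digraph.awalk\<close> for arbitrary paths, \<^const>\<open>pre_digraph.apath\<close> for simple
  ones.
\<close>

definition shortest_path ::
  "('a, 'b) pre_digraph \<Rightarrow> ('b \<Rightarrow> real) \<Rightarrow> 'a \<Rightarrow> 'b list \<Rightarrow> 'a \<Rightarrow> bool" where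
  "shortest_path D c s p t \<longleftrightarrow>
     pre_digraph.awalk D s p t \<and>
     (\<forall>p'. pre_digraph.awalk D s p' t \<longrightarrow>
        wf_digraph.awalk_cost c p \<le> wf_digraph.awalk_cost c p')"

definition path_cost2 :: "('b \<Rightarrow> real \<times> real) \<Rightarrow> 'b list \<Rightarrow> real \<times> real" where
  "path_cost2 \<gamma> q =
     (wf_digraph.awalk_cost (\<lambda>a. fst (\<gamma> a)) q, wf_digraph.awalk_cost (\<lambda>a. snd (\<gamma> a)) q)"

definition dominates :: "('b \<Rightarrow> real \<times> real) \<Rightarrow> 'b list \<Rightarrow> 'b list \<Rightarrow> bool" where
  "dominates \<gamma> q' q \<longleftrightarrow>
     fst (path_cost2 \<gamma> q') \<le> fst (path_cost2 \<gamma> q) \<and>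
     snd (path_cost2 \<gamma> q') \<le> snd (path_cost2 \<gamma> q) \<and>
     (fst (path_cost2 \<gamma> q') < fst (path_cost2 \<gamma> q) \<or>
      snd (path_cost2 \<gamma> q') < snd (path_cost2 \<gamma> q))"

definition efficient ::
  "('a, 'b) pre_digraph \<Rightarrow> 'a \<Rightarrow> 'a \<Rightarrow> ('b \<Rightarrow> real \<times> real) \<Rightarrow> 'b list \<Rightarrow> bool" where
  "efficient D s t \<gamma> q \<longleftrightarrow>
     pre_digraph.apath D s q t \<and>
     \<not> (\<exists>q'. pre_digraph.apath D s q' t \<and> dominates \<gamma> q' q)"

definition lex_le :: "real \<times> real \<Rightarrow> real \<times> real \<Rightarrow> bool" where
  "lex_le x y \<longleftrightarrow> fst x < fst y \<or> (fst x = fst y \<and> snd x \<le> snd y)"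

definition lex_smallest :: "('b \<Rightarrow> real \<times> real) \<Rightarrow> 'b list set \<Rightarrow> 'b list \<Rightarrow> bool" where
  "lex_smallest \<gamma> Q q \<longleftrightarrow>
     q \<in> Q \<and> (\<forall>q' \<in> Q. lex_le (path_cost2 \<gamma> q) (path_cost2 \<gamma> q'))"

definition gamma :: "('b \<Rightarrow> real) \<Rightarrow> 'b list \<Rightarrow> 'b \<Rightarrow> real \<times> real" where
  "gamma c p a = (c a, if a \<in> set p then 1 else 0)"

definition second_shortest_simple_path ::
  "('a, 'b) pre_digraph \<Rightarrow> ('b \<Rightarrow> real) \<Rightarrow> 'a \<Rightarrow> 'a \<Rightarrow> 'b list \<Rightarrow> 'b list \<Rightarrow> bool" where
  "second_shortest_simple_path D c s t p q \<longleftrightarrow>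
     pre_digraph.apath D s q t \<and> q \<noteq> p \<and>
     (\<forall>q'. pre_digraph.apath D s q' t \<and> q' \<noteq> p \<longrightarrow>
        wf_digraph.awalk_cost c q \<le> wf_digraph.awalk_cost c q')"

end

theory Submission
  imports Defs
begin

text \<open>
  A simple \<open>s\<close>-\<open>t\<close>-path \<open>q' \<noteq> p\<close> cannot use all arcs of \<open>p\<close>: along \<open>q'\<close> the tails are distinct and
  differ from \<open>t\<close>, so a walk from \<open>s\<close> to \<open>t\<close> inside \<open>q'\<close> is forced to follow \<open>q'\<close>. Hence
  \<open>\<gamma>\<^sub>2(q') < \<ell>\<close>. As there are finitely many simple paths, \<open>q'\<close> is weakly dominated by an efficient
  path, which again has \<open>\<gamma>\<^sub>2 < \<ell>\<close> and therefore costs at least as much as \<open>q\<close>.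
\<close>

lemma (in wf_digraph) awalk_verts_conv_tail:
  "awalk u q v \<Longrightarrow> awalk_verts u q = map (tail G) q @ [v]"
  by (induction q arbitrary: u) (auto simp: awalk_Cons_iff awalk_Nil_iff)

lemma (in wf_digraph) apath_tails:
  assumes "apath u q v"
  shows "distinct (map (tail G) q)" and "v \<notin> tail G ` set q"
  using assms by (auto simp: apath_def awalk_verts_conv_tail)

text \<open>Induction on \<open>p\<close> needs a moving start vertex \<open>u\<close>, so
  \<open>p\<close> is compared with the suffix \<open>q'\<close> of \<open>q\<close> that starts at
  \<open>u\<close>. The prefix \<open>r\<close> only records that the arcs of \<open>q'\<close>
  belong to \<open>q\<close>.\<close>

lemma (in wf_digraph) awalk_within_apath_eq_suffix:
  assumes "apath s q t" and "awalk u p t" and "set p \<subseteq> set q"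
    and "q = r @ q'" and "awalk u q' t"
  shows "p = q'"
  using assms(2-)
proof (induction p arbitrary: u r q')
  case Nil
  then have "u = t" by (simp add: awalk_Nil_iff)
  \<comment> \<open>A nonempty \<open>q'\<close> would begin with an arc of \<open>q\<close> leaving
    \<open>t\<close>.\<close>
  with Nil apath_tails(2)[OF assms(1)] show ?case
    by (cases q') (auto simp: awalk_Cons_iff)
next
  case (Cons a p)
  have a: "a \<in> set q" "tail G a = u" "awalk (head G a) p t"
    using Cons.prems by (auto simp: awalk_Cons_iff)
  with apath_tails(2)[OF assms(1)] have "u \<noteq> t" by auto
  then obtain b q'' where q': "q' = b # q''"
    using Cons.prems(4) by (cases q') (auto simp: awalk_Nil_iff)
  then have b: "b \<in> set q" "tail G b = u" "awalk (head G b) q'' t"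
    using Cons.prems by (auto simp: awalk_Cons_iff)
  have "a = b"
    using apath_tails(1)[OF assms(1)] a b by (auto simp: distinct_map dest: inj_onD)
  moreover have "p = q''"
    using Cons.IH[of "head G a" "r @ [b]" q''] a b Cons.prems q' \<open>a = b\<close> by auto
  ultimately show ?case using q' by simp
qed

lemma (in wf_digraph) snd_path_cost2_gamma:
  fixes p q :: "'b list"
  shows "snd (path_cost2 (gamma c p) q) = real (length (filter (\<lambda>a. a \<in> set p) q))"
  by (induction q) (auto simp: path_cost2_def gamma_def)

lemma (in wf_digraph) fst_path_cost2_gamma:
  fixes p q :: "'b list"
  shows "fst (path_cost2 (gamma c p) q) = awalk_cost c q"
  by (simp add: path_cost2_def gamma_def)

text \<open>The arcs of \<open>q\<close> are distinct, so the count is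
  \<open>card (set q \<inter> set p)\<close>. Some arc of \<open>p\<close> lies outside
  \<open>q\<close>, since otherwise \<open>p = q\<close>. The walk \<open>p\<close> may repeat arcs,
  hence the final bound \<open>card (set p) \<le> length p\<close>.\<close>

lemma (in wf_digraph) apath_shared_arcs_less:
  assumes "awalk s p t" and "apath s q t" and "q \<noteq> p"
  shows "length (filter (\<lambda>a. a \<in> set p) q) < length p"
proof -
  have "distinct q"
    using apath_tails(1)[OF assms(2)] by (simp add: distinct_map)
  then have "length (filter (\<lambda>a. a \<in> set p) q) = card (set q \<inter> set p)"
    using distinct_card[of "filter (\<lambda>a. a \<in> set p) q"] by (simp add: Int_def)
  moreover have "\<not> set p \<subseteq> set q"
    using awalk_within_apath_eq_suffix[OF assms(2,1), of "[]" q] assms by (auto simp: apath_def)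
  then have "card (set q \<inter> set p) < card (set p)"
    by (intro psubset_card_mono) auto
  ultimately show ?thesis
    using card_length[of p] by linarith
qed

text \<open>Among the finitely many simple paths no worse than \<open>q\<close> in both components,
  one with minimal component sum is efficient: a path dominating it would lie in the same set and
  have a smaller sum.\<close>

lemma (in fin_digraph) efficient_below_apath:
  assumes "apath s q t"
  obtains r where "efficient G s t \<gamma> r"
    and "fst (path_cost2 \<gamma> r) \<le> fst (path_cost2 \<gamma> q)"
    and "snd (path_cost2 \<gamma> r) \<le> snd (path_cost2 \<gamma> q)"
proof -
  let ?f = "\<lambda>r. fst (path_cost2 \<gamma> r) + snd (path_cost2 \<gamma> r)"
  define S where "S = {r. apath s r t \<and> fst (path_cost2 \<gamma> r) \<le> fst (path_cost2 \<gamma> q)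
    \<and> snd (path_cost2 \<gamma> r) \<le> snd (path_cost2 \<gamma> q)}"
  have "finite S"
    using apaths_finite[of s t] by (rule rev_finite_subset) (auto simp: S_def)
  moreover have "q \<in> S" using assms by (simp add: S_def)
  ultimately obtain r where "is_arg_min ?f (\<lambda>r. r \<in> S) r"
    using ex_is_arg_min_if_finite[of S ?f] by auto
  then have r: "r \<in> S" "\<And>r'. r' \<in> S \<Longrightarrow> ?f r \<le> ?f r'"
    by (auto simp: is_arg_min_linorder)
  have "\<not> dominates \<gamma> r' r" if "apath s r' t" for r'
  proof
    assume d: "dominates \<gamma> r' r"
    then have "r' \<in> S" using r(1) that by (auto simp: S_def dominates_def)
    with r(2)[of r'] d show False by (auto simp: dominates_def)
  qed
  then have "efficient G s t \<gamma> r"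
    using r(1) by (auto simp: efficient_def S_def)
  then show thesis
    using that r(1) by (auto simp: S_def)
qed

theorem theorem3:
  fixes D :: "('a, 'b) pre_digraph"
    and s t :: 'a
    and c :: "'b \<Rightarrow> real"
    and p q :: "'b list"
  assumes "fin_digraph D"
    and "s \<in> verts D" and "t \<in> verts D" and "s \<noteq> t"
    and "\<forall>a \<in> arcs D. 0 \<le> c a"
    and "shortest_path D c s p t"
    and "lex_smallest (gamma c p)
           {q'. efficient D s t (gamma c p) q' \<and>
                snd (path_cost2 (gamma c p) q') < real (length p)} q"
  shows "second_shortest_simple_path D c s t p q"
proof -
  interpret fin_digraph D by fact
  have p: "awalk s p t" using assms(6) by (simp add: shortest_path_def)
  have q: "apath s q t" "snd (path_cost2 (gamma c p) q) < real (length p)"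
    using assms(7) by (auto simp: lex_smallest_def efficient_def)
  \<comment> \<open>For \<open>q = p\<close> every arc is counted, so the second cost would equal
    \<open>length p\<close>.\<close>
  have "q \<noteq> p" using q(2) by (auto simp: snd_path_cost2_gamma)
  moreover have "awalk_cost c q \<le> awalk_cost c q'" if q': "apath s q' t" "q' \<noteq> p" for q'
  proof -
    obtain r where r: "efficient D s t (gamma c p) r"
      "fst (path_cost2 (gamma c p) r) \<le> fst (path_cost2 (gamma c p) q')"
      "snd (path_cost2 (gamma c p) r) \<le> snd (path_cost2 (gamma c p) q')"
      using efficient_below_apath[OF q'(1)] by blast
    moreover have "snd (path_cost2 (gamma c p) q') < real (length p)"
      using apath_shared_arcs_less[OF p q'] by (simp add: snd_path_cost2_gamma)
    \<comment> \<open>The second cost of \<open>r\<close> is at most that of \<open>q'\<close>,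
      hence below \<open>length p\<close>, so \<open>r\<close> is among the candidates over which
      \<open>q\<close> is minimal.\<close>
    ultimately have "lex_le (path_cost2 (gamma c p) q) (path_cost2 (gamma c p) r)"
      using assms(7) by (auto simp: lex_smallest_def)
    with r(2) show ?thesis by (auto simp: lex_le_def fst_path_cost2_gamma)
  qed
  ultimately show ?thesis using q(1) by (simp add: second_shortest_simple_path_def)
qed

end
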